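(* Let $p\ge 1$, and let $S_{\Gamma\Gamma}^{(i)}$, $d_\Gamma^{(i)}$, $I_{\Gamma\Gamma}^{(i)}$ ($i\in\{1,\dots,p\}$) and $M_{\Gamma\Gamma}$ be as described in the context (with $\sum_{i=1}^p I_{\Gamma\Gamma}^{(i)}=I_{\Gamma\Gamma}$ and $M_{\Gamma\Gamma}$ nonsingular). If $$\rho\left(\sum_{i=1}^{p}\left|I_{\Gamma\Gamma}^{(i)}-M_{\Gamma\Gamma}^{-1}S_{\Gamma\Gamma}^{(i)}\right|\right)<1,$$ then the asynchronous primal Schur method is convergent.
   Context: Matrices and vectors have entries in $\mathbb{K}=\mathbb{R}$ or $\mathbb{C}$. $\rho(\cdot)$ is the spectral radius and $|\mathcal A|$ is the entry-wise absolute value of a matrix or vector $\mathcal A$. Setting (primal Schur domain decomposition with $p$ subdomains and interface $\Gamma$). For each $i\in\{1,\dots,p\}$ one is given matrices $A_{II}^{(i)}$ (square, nonsingular), $A_{I\Gamma}^{(i)}$, $A_{\Gamma I}^{(i)}$, $A_{\Gamma\Gamma}^{(i)}$ and vectors $b_I^{(i)}$, $b_\Gamma^{(i)}$ of compatible sizes; the size of the $I$-blocks may depend on $i$, and the index $\Gamma$ refers to one common finite index set. (When subdomain $i$ touches only a part $\Gamma_l$ of $\Gamma$, these blocks are obtained from local blocks through a Boolean restriction matrix $R^{(i)}_{\Gamma_l\Gamma}$ from $\Gamma$ to $\Gamma_l$, e.g. $A_{\Gamma\Gamma}^{(i)}={R^{(i)}_{\Gamma_l\Gamma}}^{\mathsf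 T}A^{(i)}_{\Gamma_l\Gamma_l}R^{(i)}_{\Gamma_l\Gamma}$.) Define $$S_{\Gamma\Gamma}^{(i)}:=A_{\Gamma\Gamma}^{(i)}-A_{\Gamma I}^{(i)}{A_{II}^{(i)}}^{-1}A_{I\Gamma}^{(i)},\quad d_\Gamma^{(i)}:=b_\Gamma^{(i)}-A_{\Gamma I}^{(i)}{A_{II}^{(i)}}^{-1}b_I^{(i)},\quad S_{\Gamma\Gamma}:=\sum_{i=1}^pS_{\Gamma\Gamma}^{(i)},\quad d_\Gamma:=\sum_{i=1}^pd_\Gamma^{(i)}.$$ The interface problem is $S_{\Gamma\Gamma}x_\Gamma=d_\Gamma$. Let $I_{\Gamma\Gamma}$ be the identity matrix on $\Gamma$, let $M_{\Gamma\Gamma}$ be a nonsingular matrix on $\Gamma$, and let $I_{\Gamma\Gamma}^{(1)},\dots,I_{\Gamma\Gamma}^{(p)}$ be matrices on $\Gamma$ with $\sum_{i=1}^pI_{\Gamma\Gamma}^{(i)}=I_{\Gamma\Gamma}$. Asynchronous primal Schur method. Given initial vectors $x_\Gamma^{(i),0}$ ($i\in\{1,\dots,p\}$), sets $P^{(k)}\subseteq\{1,\dots,p\}$ ($k\in\mathbb{N}$) and maps $\tau_j^i:\mathbb{N}\to\mathbb{N}$ ($i,j\in\{1,\dots,p\}$) with $\tau_j^i(k)\le k$, such that (a) for every $i$, the set $\{k\in\mathbb{N}: i\in P^{(k)}\}$ is infinite, and (b) for all $i,j$, $\lim_{k\to\infty}\tau_j^i(k)=+\infty$, the method generates, for $k\in\mathbb{N}$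 and $i\in\{1,\dots,p\}$, $$y_\Gamma^{(i),k}:=I_{\Gamma\Gamma}^{(i)}x_\Gamma^{(i),k}+M_{\Gamma\Gamma}^{-1}\left(d_\Gamma^{(i)}-S_{\Gamma\Gamma}^{(i)}x_\Gamma^{(i),k}\right),\qquad x_\Gamma^{(i),k+1}=\begin{cases}\sum_{j=1}^py_\Gamma^{(j),\tau_j^i(k)},& i\in P^{(k)},\\ x_\Gamma^{(i),k},& i\notin P^{(k)}.\end{cases}$$ The method is called convergent if, for all choices of the initial vectors $x_\Gamma^{(i),0}$, of sets $P^{(k)}\subseteq\{1,\dots,p\}$ such that $\{k\in\mathbb{N}: i\in P^{(k)}\}$ is infinite for every $i$, and of maps $\tau_j^i:\mathbb{N}\to\mathbb{N}$ such that $\tau_j^i(k)\le k$ for all $k$ and $\lim_{k\to\infty}\tau_j^i(k)=+\infty$ for all $i,j$, each sequence $(x_\Gamma^{(i),k})_{k}$, $i\in\{1,\dots,p\}$, converges as $k\to\infty$ to the solution $x_\Gamma$ of $S_{\Gamma\Gamma}x_\Gamma=d_\Gamma$. *)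

theory Defs
  imports
    "Jordan_Normal_Form.Gauss_Jordan_Elimination"
    "Jordan_Normal_Form.Spectral_Radius"
begin

text \<open>
  The scalar type ranges over \<^class>\<open>real_normed_field\<close>, whose norm is multiplicative; by the
  Gelfand--Mazur theorem its instances are, up to isometric isomorphism, the real and the
  complex numbers, with \<^const>\<open>norm\<close> being the absolute value.
\<close>

text \<open>Only applied to invertible matrices, for which \<^const>\<open>mat_inverse\<close> does not return \<open>None\<close>.\<close>

abbreviation minv :: "'a :: field mat \<Rightarrow> 'a mat" where
  "minv A \<equiv> the (mat_inverse A)"

lemma minv_inverse:
  assumes A: "A \<in> carrier_mat n n" and inv: "invertible_mat A"
  shows "minv A \<in> carrier_mat n n" "A * minv A = 1\<^sub>m n" "minv A * A = 1\<^sub>m n"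
proof -
  obtain B where B: "A * B = 1\<^sub>m n" "B * A = 1\<^sub>m (dim_row B)"
    using A inv unfolding invertible_mat_def inverts_mat_def by auto
  have "dim_col B = n" using arg_cong[OF B(1), of dim_col] by simp
  moreover have "dim_row B = n" using arg_cong[OF B(2), of dim_col] A by simp
  ultimately have "B \<in> carrier_mat n n" by auto
  with A B have "A \<in> Units (ring_mat TYPE('a) n ())"
    unfolding Units_def ring_mat_def by auto
  with mat_inverse(1)[OF A, where b = "()"] obtain C where "mat_inverse A = Some C"
    by (cases "mat_inverse A") auto
  with mat_inverse(2)[OF A this]
  show "minv A \<in> carrier_mat n n" "A * minv A = 1\<^sub>m n" "minv A * A = 1\<^sub>m n" by auto
qed

abbreviation finsum_mat :: "nat \<Rightarrow> ('i \<Rightarrow> 'a :: semiring_1 mat) \<Rightarrow> 'i set \<Rightarrow> 'a mat" where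
  "finsum_mat n \<equiv> finsum (module_mat TYPE('a) n n)"

lemma index_finsum_mat:
  fixes f :: "'i \<Rightarrow> 'a :: comm_ring_1 mat"
  assumes "finite I" "\<And>i. i \<in> I \<Longrightarrow> f i \<in> carrier_mat n n" "r < n" "c < n"
  shows "finsum_mat n f I \<in> carrier_mat n n \<and> finsum_mat n f I $$ (r, c) = (\<Sum>i\<in>I. f i $$ (r, c))"
proof -
  interpret abelian_group "module_mat TYPE('a) n n" by (rule abelian_group_mat)
  have carr: "carrier (module_mat TYPE('a) n n) = carrier_mat n n"
    and add: "add (module_mat TYPE('a) n n) = (+)"
    and zero: "zero (module_mat TYPE('a) n n) = 0\<^sub>m n n"
    by (auto simp: module_mat_def)
  show ?thesis
    using assms(1,2)
  proof (induction I rule: finite_induct)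
    case empty
    then show ?case using assms(3,4) by (simp add: zero)
  next
    case (insert i I)
    have "finsum_mat n f (insert i I) = f i + finsum_mat n f I"
      using insert by (subst finsum_insert) (auto simp: carr add)
    moreover have "f i \<in> carrier_mat n n" using insert.prems by simp
    ultimately show ?case using insert assms(3,4) by auto
  qed
qed

abbreviation abs_mat :: "'a :: real_normed_field mat \<Rightarrow> real mat" where
  "abs_mat \<equiv> map_mat norm"

abbreviation real_spectral_radius :: "real mat \<Rightarrow> real" where
  "real_spectral_radius A \<equiv> spectral_radius (map_mat complex_of_real A)"

definition schur_complement ::
  "'a :: field mat \<Rightarrow> 'a mat \<Rightarrow> 'a mat \<Rightarrow> 'a mat \<Rightarrow> 'a mat" where
  "schur_complement A_II A_IG A_GI A_GG = A_GG - A_GI * minv A_II * A_IG"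

definition condensed_rhs ::
  "'a :: field mat \<Rightarrow> 'a mat \<Rightarrow> 'a vec \<Rightarrow> 'a vec \<Rightarrow> 'a vec" where
  "condensed_rhs A_II A_GI b_I b_G = b_G - (A_GI * minv A_II) *\<^sub>v b_I"

definition interface_solution ::
  "nat \<Rightarrow> nat \<Rightarrow> (nat \<Rightarrow> 'a :: field mat) \<Rightarrow> (nat \<Rightarrow> 'a vec) \<Rightarrow> 'a vec \<Rightarrow> bool" where
  "interface_solution n p S d x \<longleftrightarrow>
     x \<in> carrier_vec n \<and> finsum_mat n S {1..p} *\<^sub>v x = finsum_vec TYPE('a) n d {1..p}"

definition async_schedule ::
  "nat \<Rightarrow> (nat \<Rightarrow> nat set) \<Rightarrow> (nat \<Rightarrow> nat \<Rightarrow> nat \<Rightarrow> nat) \<Rightarrow> bool" where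
  "async_schedule p P \<tau> \<longleftrightarrow>
     (\<forall>k. P k \<subseteq> {1..p}) \<and>
     (\<forall>i\<in>{1..p}. infinite {k. i \<in> P k}) \<and>
     (\<forall>i\<in>{1..p}. \<forall>j\<in>{1..p}. (\<forall>k. \<tau> i j k \<le> k) \<and> filterlim (\<tau> i j) at_top at_top)"

definition local_update ::
  "'a :: field mat \<Rightarrow> 'a mat \<Rightarrow> 'a mat \<Rightarrow> 'a vec \<Rightarrow> 'a vec \<Rightarrow> 'a vec" where
  "local_update J M S d x = J *\<^sub>v x + minv M *\<^sub>v (d - S *\<^sub>v x)"

text \<open>\<open>J i\<close> is the partition-of-unity matrix of subdomain \<open>i\<close>, \<open>x i k\<close> its \<open>k\<close>-th iterate, and
  \<open>\<tau> i j k\<close> the index of the contribution of \<open>j\<close> that \<open>i\<close> uses in step \<open>k\<close>.\<close>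

definition async_primal_schur_iterates ::
  "nat \<Rightarrow> nat \<Rightarrow> (nat \<Rightarrow> 'a :: field mat) \<Rightarrow> 'a mat \<Rightarrow> (nat \<Rightarrow> 'a mat) \<Rightarrow> (nat \<Rightarrow> 'a vec) \<Rightarrow>
   (nat \<Rightarrow> nat set) \<Rightarrow> (nat \<Rightarrow> nat \<Rightarrow> nat \<Rightarrow> nat) \<Rightarrow> (nat \<Rightarrow> nat \<Rightarrow> 'a vec) \<Rightarrow> bool" where
  "async_primal_schur_iterates n p J M S d P \<tau> x \<longleftrightarrow>
     (\<forall>i\<in>{1..p}. x i 0 \<in> carrier_vec n) \<and>
     (\<forall>k. \<forall>i\<in>{1..p}. x i (Suc k) =
        (if i \<in> P k
         then finsum_vec TYPE('a) n
                (\<lambda>j. local_update (J j) M (S j) (d j) (x j (\<tau> i j k))) {1..p}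
         else x i k))"

text \<open>The type of vectors carries no topology; convergence in the finite-dimensional space
  of vectors of size \<open>n\<close> is convergence of all components.\<close>

definition vec_tendsto ::
  "nat \<Rightarrow> (nat \<Rightarrow> 'a :: real_normed_field vec) \<Rightarrow> 'a vec \<Rightarrow> bool" where
  "vec_tendsto n v l \<longleftrightarrow> (\<forall>r<n. (\<lambda>k. v k $ r) \<longlonglongrightarrow> l $ r)"

text \<open>Convergence to ``the solution'' includes its existence and uniqueness.\<close>

definition async_primal_schur_convergent ::
  "nat \<Rightarrow> nat \<Rightarrow> (nat \<Rightarrow> 'a :: real_normed_field mat) \<Rightarrow> 'a mat \<Rightarrow> (nat \<Rightarrow> 'a mat) \<Rightarrow>
   (nat \<Rightarrow> 'a vec) \<Rightarrow> bool" where
  "async_primal_schur_convergent n p J M S d \<longleftrightarrow>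
     (\<exists>!x. interface_solution n p S d x) \<and>
     (\<forall>xsol P \<tau> x. interface_solution n p S d xsol \<longrightarrow> async_schedule p P \<tau> \<longrightarrow>
        async_primal_schur_iterates n p J M S d P \<tau> x \<longrightarrow>
        (\<forall>i\<in>{1..p}. vec_tendsto n (x i) xsol))"

end

theory Submission
  imports Defs
begin

text \<open>
  With \<open>N\<^sub>j = J\<^sub>j - M\<^sup>-\<^sup>1 S\<^sub>j\<close> the contribution of subdomain \<open>j\<close> is the affine map
  \<open>x \<mapsto> N\<^sub>j x + M\<^sup>-\<^sup>1 d\<^sub>j\<close>. A solution \<open>y\<close> of the interface problem is reproduced by the sum of these
  maps, because the \<open>J\<^sub>j\<close> sum to the identity and the residuals \<open>d\<^sub>j - S\<^sub>j y\<close> sum to zero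
  (\<open>solution_fixed_point\<close>). So an update replaces the error of one subdomain by
  \<open>\<Sum>\<^sub>j N\<^sub>j e\<^sub>j\<close>, where the \<open>e\<^sub>j\<close> are old errors of the subdomains, taken at different times.

  Let \<open>B = \<Sum>\<^sub>j |N\<^sub>j|\<close>. Since \<open>B\<close> is nonnegative with spectral radius below one, there are a positive
  vector \<open>w\<close> and \<open>\<alpha> < 1\<close> with \<open>B w \<le> \<alpha> w\<close> (\<open>nonneg_mat_positive_weight\<close>). Hence if all old errors
  satisfy \<open>|e\<^sub>j| \<le> C w\<close>, the new one satisfies \<open>|e| \<le> \<alpha> C w\<close> (\<open>weighted_contraction\<close>), no matter how
  the delays mix the old iterates. The boxes \<open>|x - y| \<le> \<alpha>\<^sup>t C w\<close> thus form a nested sequence such that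
  data in one box produce updates in the next; as every subdomain is updated infinitely often and
  the delayed indices tend to infinity, all iterates eventually stay in each of the boxes
  (\<open>async_nested_sets\<close>), and the boxes shrink to \<open>y\<close>.

  Existence and uniqueness of the solution come out of the convergence itself: a solution gives rise
  to a constant run of the method, which converges to any other solution. For the zero right-hand
  side this shows that the interface matrix has trivial kernel, so it is invertible.
\<close>

section \<open>Nonnegative matrices of spectral radius below one\<close>

lemma smult_pow_mat:
  fixes A :: "'a :: comm_semiring_1 mat"
  assumes A: "A \<in> carrier_mat n n"
  shows "(a \<cdot>\<^sub>m A) ^\<^sub>m k = a ^ k \<cdot>\<^sub>m A ^\<^sub>m k"
proof (induction k)
  case 0
  then show ?case using A by (intro eq_matI) auto
next
  case (Suc k)
  have P: "A ^\<^sub>m k \<in> carrier_mat n n" using A by simp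
  show ?case
    using A P Suc
    by (simp add: mult_smult_assoc_mat[OF P, of _ n] mult_smult_distrib[of _ n n _ n])
       (intro eq_matI, auto simp: ac_simps)
qed

lemma eigenvalue_smult:
  fixes A :: "'a :: field mat"
  assumes A: "A \<in> carrier_mat n n" and a: "a \<noteq> 0" and ev: "eigenvalue (a \<cdot>\<^sub>m A) e"
  shows "eigenvalue A (e / a)"
proof -
  from ev A obtain v where v: "v \<in> carrier_vec n" "v \<noteq> 0\<^sub>v n"
    and eq: "(a \<cdot>\<^sub>m A) *\<^sub>v v = e \<cdot>\<^sub>v v"
    unfolding eigenvalue_def eigenvector_def by auto
  have "A *\<^sub>v v = (e / a) \<cdot>\<^sub>v v"
  proof (rule eq_vecI)
    fix i assume "i < dim_vec ((e / a) \<cdot>\<^sub>v v)"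
    then have i: "i < n" using v by simp
    have "((a \<cdot>\<^sub>m A) *\<^sub>v v) $ i = a * ((A *\<^sub>v v) $ i)"
      using i A v by (simp add: row_smult scalar_prod_smult_left)
    moreover have "(e \<cdot>\<^sub>v v) $ i = e * v $ i" using i v by simp
    ultimately have "a * ((A *\<^sub>v v) $ i) = e * v $ i" using eq by simp
    then show "(A *\<^sub>v v) $ i = ((e / a) \<cdot>\<^sub>v v) $ i"
      using i v a by (simp add: field_simps)
  qed (use A v in auto)
  then show ?thesis using v A unfolding eigenvalue_def eigenvector_def by auto
qed

text \<open>
  Powers of a matrix of spectral radius below one are bounded. To get decay, this is applied to
  \<open>A / r\<close> with \<open>r\<close> strictly between the spectral radius and one.
\<close>

lemma pow_mat_geometric_decay:
  assumes A: "A \<in> carrier_mat n n" and sr: "spectral_radius A < 1"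
  obtains c r where "0 < r" "r < 1" "\<And>k. norm_bound (A ^\<^sub>m k) (c * r ^ k)"
proof (cases "n = 0")
  case True
  have "norm_bound (A ^\<^sub>m k) (0 * (1/2) ^ k)" for k
    using A True by (auto simp: norm_bound_def)
  then show ?thesis using that[of "1/2" 0] by simp
next
  case False
  then have n: "n > 0" by simp
  obtain r where r: "spectral_radius A < r" "0 < r" "r < 1"
  proof -
    have "max 0 (spectral_radius A) < 1" using sr by simp
    then obtain r where "max 0 (spectral_radius A) < r" "r < 1" using dense by blast
    then show ?thesis using that[of r] by simp
  qed
  define a where "a = complex_of_real (1 / r)"
  have a: "a \<noteq> 0" and na: "norm a = 1 / r" using r by (auto simp: a_def norm_divide)
  have aA: "a \<cdot>\<^sub>m A \<in> carrier_mat n n" using A by simp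
  obtain e where e: "eigenvalue (a \<cdot>\<^sub>m A) e" "spectral_radius (a \<cdot>\<^sub>m A) = norm e"
    using spectral_radius_mem_max(1)[OF aA n] by (auto simp: spectrum_def)
  have "norm (e / a) \<le> spectral_radius A"
    using eigenvalue_smult[OF A a e(1)]
    by (intro spectral_radius_mem_max(2)[OF A n]) (simp add: spectrum_def)
  then have "norm e * r \<le> spectral_radius A" by (simp add: norm_divide na)
  then have "norm e * r < r" using r by linarith
  then have "norm e < 1" using r by simp
  then obtain c where c: "norm_bound ((a \<cdot>\<^sub>m A) ^\<^sub>m k) c" for k
    using spectral_radius_jnf_norm_bound_less_1_upper_triangular[OF aA] e by auto
  have "norm_bound (A ^\<^sub>m k) (c * r ^ k)" for k
  proof (rule norm_boundI)
    fix i j assume "i < dim_row (A ^\<^sub>m k)" "j < dim_col (A ^\<^sub>m k)"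
    then have ij: "i < dim_row (A ^\<^sub>m k)" "j < dim_col (A ^\<^sub>m k)" .
    have "norm (((a \<cdot>\<^sub>m A) ^\<^sub>m k) $$ (i, j)) \<le> c"
      using c[of k] ij unfolding norm_bound_def smult_pow_mat[OF A] by simp
    then have "(1 / r) ^ k * norm ((A ^\<^sub>m k) $$ (i, j)) \<le> c"
      using ij by (simp add: smult_pow_mat[OF A] norm_mult norm_power na)
    then show "norm ((A ^\<^sub>m k) $$ (i, j)) \<le> c * r ^ k"
      using r by (simp add: field_simps)
  qed
  then show ?thesis using r that by blast
qed

text \<open>
  A substitute for the Perron vector that also works for reducible matrices: with the all-one
  vector \<open>e\<close>, the truncated Neumann series \<open>w = e + B e + \<dots> + B\<^sup>N e\<close> satisfies
  \<open>B w = w - e + B\<^sup>N\<^sup>+\<^sup>1 e \<le> w - e / 2\<close> once \<open>B\<^sup>N\<^sup>+\<^sup>1 e \<le> e / 2\<close>.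
\<close>

lemma nonneg_mat_positive_weight:
  fixes B :: "real mat"
  assumes B: "B \<in> carrier_mat n n"
    and nonneg: "\<And>i j. i < n \<Longrightarrow> j < n \<Longrightarrow> 0 \<le> B $$ (i, j)"
    and sr: "real_spectral_radius B < 1"
  shows "\<exists>\<alpha> w. 0 < \<alpha> \<and> \<alpha> < 1 \<and> (\<forall>i<n. 0 < w i) \<and>
    (\<forall>i<n. (\<Sum>j<n. B $$ (i, j) * w j) \<le> \<alpha> * w i)"
proof -
  \<comment> \<open>\<open>u k\<close> is the vector of row sums of \<open>B\<close> to the power \<open>k\<close>, that is, this power applied to the
     all-one vector.\<close>
  define u where "u k i = (\<Sum>j<n. (B ^\<^sub>m k) $$ (i, j))" for k i
  have Bk: "B ^\<^sub>m k \<in> carrier_mat n n" for k using B by simp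
  have pow_Suc: "B ^\<^sub>m Suc k = B * B ^\<^sub>m k" for k
  proof (induction k)
    case (Suc k)
    then show ?case using B Bk[of k] by (metis assoc_mult_mat pow_mat.simps(2))
  qed (use B in simp)
  have entry_Suc: "(B ^\<^sub>m Suc k) $$ (i, j) = (\<Sum>l<n. B $$ (i, l) * (B ^\<^sub>m k) $$ (l, j))"
    if "i < n" "j < n" for i j k
    using that B Bk[of k] unfolding pow_Suc by (simp add: scalar_prod_def atLeast0LessThan)
  have pow_nonneg: "0 \<le> (B ^\<^sub>m k) $$ (i, j)" if "i < n" "j < n" for i j k
    using that
  proof (induction k arbitrary: i j)
    case 0
    then show ?case using B by simp
  next
    case (Suc k)
    show ?case unfolding entry_Suc[OF Suc.prems]
      using Suc nonneg by (intro sum_nonneg mult_nonneg_nonneg) auto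
  qed
  have u_nonneg: "0 \<le> u k i" if "i < n" for k i
    unfolding u_def using that pow_nonneg by (intro sum_nonneg) auto
  have u_0: "u 0 i = 1" if "i < n" for i
    using that B by (simp add: u_def)
  have u_Suc: "u (Suc k) i = (\<Sum>j<n. B $$ (i, j) * u k j)" if "i < n" for k i
  proof -
    have "u (Suc k) i = (\<Sum>j<n. \<Sum>l<n. B $$ (i, l) * (B ^\<^sub>m k) $$ (l, j))"
      using that by (simp add: u_def entry_Suc del: pow_mat.simps)
    also have "\<dots> = (\<Sum>l<n. \<Sum>j<n. B $$ (i, l) * (B ^\<^sub>m k) $$ (l, j))"
      by (rule sum.swap)
    finally show ?thesis by (simp add: u_def sum_distrib_left)
  qed
  have "map_mat complex_of_real B \<in> carrier_mat n n" using B by simp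
  from pow_mat_geometric_decay[OF this sr] obtain c r where r: "0 < r" "r < 1"
    and bound: "\<And>k. norm_bound (map_mat complex_of_real B ^\<^sub>m k) (c * r ^ k)" by blast
  have entry_le: "(B ^\<^sub>m k) $$ (i, j) \<le> c * r ^ k" if "i < n" "j < n" for i j k
  proof -
    have "norm (map_mat complex_of_real (B ^\<^sub>m k) $$ (i, j)) \<le> c * r ^ k"
      using bound[of k] that Bk[of k] B
      unfolding of_real_hom.mat_hom_pow[OF B] norm_bound_def by simp
    moreover have "map_mat complex_of_real (B ^\<^sub>m k) $$ (i, j) = complex_of_real ((B ^\<^sub>m k) $$ (i, j))"
      using that Bk[of k] by (intro index_map_mat) auto
    ultimately have "\<bar>(B ^\<^sub>m k) $$ (i, j)\<bar> \<le> c * r ^ k" by (simp only: norm_of_real)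
    then show ?thesis by linarith
  qed
  have "(\<lambda>k. real n * (c * r ^ k)) \<longlonglongrightarrow> real n * (c * 0)"
    using r by (intro tendsto_intros LIMSEQ_power_zero) simp
  then have "eventually (\<lambda>k. real n * (c * r ^ k) < 1 / 2) sequentially"
    by (intro order_tendstoD(2)) auto
  then obtain N where N: "real n * (c * r ^ Suc N) < 1 / 2"
    unfolding eventually_sequentially by (meson le_SucI order_refl)
  have u_N: "u (Suc N) i \<le> 1 / 2" if "i < n" for i
  proof -
    have "u (Suc N) i \<le> (\<Sum>j<n. c * r ^ Suc N)"
      unfolding u_def using that by (intro sum_mono entry_le) auto
    then show ?thesis using N by simp
  qed
  define w where "w i = (\<Sum>k<Suc N. u k i)" for i
  have w_ge_1: "1 \<le> w i" if "i < n" for i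
  proof -
    have "w i = 1 + (\<Sum>k<N. u (Suc k) i)"
      unfolding w_def sum.lessThan_Suc_shift using that by (simp add: u_0)
    then show ?thesis using that u_nonneg by (simp add: sum_nonneg)
  qed
  \<comment> \<open>An upper bound of the weights turns the absolute gain of \<open>1 / 2\<close> into a relative one; the
     summand \<open>1\<close> keeps it positive in dimension zero.\<close>
  define W where "W = 1 + (\<Sum>i<n. w i)"
  have w_le: "w i \<le> W" if "i < n" for i
  proof -
    have "w i \<le> (\<Sum>i<n. w i)"
      using that w_ge_1 by (intro member_le_sum) (auto intro: order_trans[of 0 1])
    then show ?thesis by (simp add: W_def)
  qed
  have W: "1 \<le> W"
    using w_ge_1 unfolding W_def by (auto intro!: sum_nonneg intro: order_trans[of 0 1])
  have "(\<Sum>j<n. B $$ (i, j) * w j) \<le> (1 - 1 / (2 * W)) * w i" if i: "i < n" for i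
  proof -
    have "(\<Sum>j<n. B $$ (i, j) * w j) = (\<Sum>k<Suc N. u (Suc k) i)"
      unfolding w_def u_Suc[OF i] sum_distrib_left by (rule sum.swap)
    also have "\<dots> = w i - u 0 i + u (Suc N) i"
      unfolding w_def by (subst (2) sum.lessThan_Suc_shift) simp
    finally have "(\<Sum>j<n. B $$ (i, j) * w j) \<le> w i - 1 / 2"
      using u_0[OF i] u_N[OF i] by simp
    moreover have "w i / W \<le> 1" using w_le[OF i] W by simp
    ultimately show ?thesis by (simp add: algebra_simps)
  qed
  moreover have "0 < 1 - 1 / (2 * W)" "1 - 1 / (2 * W) < 1" using W by (auto simp: field_simps)
  moreover have "0 < w i" if "i < n" for i using w_ge_1[OF that] by simp
  ultimately show ?thesis
    by (intro exI[of _ "1 - 1 / (2 * W)"] exI[of _ w]) simp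
qed

section \<open>Asynchronous iterations along nested sets\<close>

text \<open>
  The asynchronous convergence theorem of Bertsekas, for updates that all draw from a common nested
  family of sets. Once all iterates lie in \<open>X t\<close> from time \<open>K\<close> on, wait until no update reads data
  older than \<open>K\<close>. From then on every update lands in \<open>X (Suc t)\<close>, so that each component enters this
  set with its next update and never leaves it again.
\<close>

lemma async_nested_sets:
  assumes sched: "async_schedule p P \<tau>"
    and nested: "\<And>t. X (Suc t) \<subseteq> X t"
    and init: "\<And>i. i \<in> {1..p} \<Longrightarrow> x i 0 \<in> X 0"
    and idle: "\<And>i k. i \<in> {1..p} \<Longrightarrow> i \<notin> P k \<Longrightarrow> x i (Suc k) = x i k"
    and step: "\<And>i k t. i \<in> {1..p} \<Longrightarrow> i \<in> P k \<Longrightarrow>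
      (\<And>j. j \<in> {1..p} \<Longrightarrow> x j (\<tau> i j k) \<in> X t) \<Longrightarrow> x i (Suc k) \<in> X (Suc t)"
  shows "\<exists>K. \<forall>k\<ge>K. \<forall>i\<in>{1..p}. x i k \<in> X t"
proof (induction t)
  case 0
  \<comment> \<open>An update from data in \<open>X 0\<close> lands in \<open>X 1\<close>, hence again in \<open>X 0\<close>.\<close>
  have "\<forall>i\<in>{1..p}. x i k \<in> X 0" for k
  proof (induction k rule: less_induct)
    case (less k)
    show ?case
    proof (cases k)
      case 0
      then show ?thesis using init by simp
    next
      case (Suc l)
      have "x i (Suc l) \<in> X 0" if i: "i \<in> {1..p}" for i
      proof (cases "i \<in> P l")
        case True
        have "x j (\<tau> i j l) \<in> X 0" if "j \<in> {1..p}" for j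
          using sched less[of "\<tau> i j l"] i that Suc unfolding async_schedule_def
          by (simp add: less_Suc_eq_le)
        then show ?thesis using step[OF i True] nested[of 0] by blast
      next
        case False
        then show ?thesis using idle[OF i] less[of l] i Suc by simp
      qed
      then show ?thesis using Suc by simp
    qed
  qed
  then show ?case by blast
next
  case (Suc t)
  then obtain K where K: "x j k \<in> X t" if "j \<in> {1..p}" "k \<ge> K" for j k by blast
  have "\<forall>\<^sub>F k in at_top. \<forall>i\<in>{1..p}. \<forall>j\<in>{1..p}. K \<le> \<tau> i j k"
    using sched unfolding async_schedule_def
    by (intro eventually_ball_finite ballI) (auto simp: filterlim_at_top)
  then obtain L where L: "K \<le> \<tau> i j k" if "k \<ge> L" "i \<in> {1..p}" "j \<in> {1..p}" for i j k
    unfolding eventually_at_top_linorder by blast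
  have upd: "x i (Suc k) \<in> X (Suc t)" if "i \<in> {1..p}" "i \<in> P k" "k \<ge> L" for i k
    using that K L by (intro step) auto
  have "\<forall>i\<in>{1..p}. \<exists>k\<ge>L. i \<in> P k"
    using sched unfolding async_schedule_def infinite_nat_iff_unbounded_le by blast
  then obtain \<kappa> where \<kappa>: "\<kappa> i \<ge> L" "i \<in> P (\<kappa> i)" if "i \<in> {1..p}" for i by metis
  have stay: "x i k \<in> X (Suc t)" if i: "i \<in> {1..p}" and "k \<ge> Suc (\<kappa> i)" for i k
    using that(2)
  proof (induction k rule: dec_induct)
    case base
    then show ?case using upd[OF i] \<kappa>[OF i] by simp
  next
    case (step k)
    then have "k \<ge> L" using \<kappa>[OF i] by simp
    then show ?case using upd[OF i] idle[OF i, of k] step by (cases "i \<in> P k") auto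
  qed
  have "Suc (\<kappa> i) \<le> (\<Sum>i\<in>{1..p}. Suc (\<kappa> i))" if "i \<in> {1..p}" for i
    using that by (intro member_le_sum) auto
  then show ?case using stay by (meson order_trans)
qed

section \<open>Weighted contraction by a family of matrices\<close>

lemma index_mult_mat_vec_sum:
  assumes "A \<in> carrier_mat n n" "v \<in> carrier_vec n" "r < n"
  shows "(A *\<^sub>v v) $ r = (\<Sum>c<n. A $$ (r, c) * v $ c)"
  using assms by (simp add: scalar_prod_def atLeast0LessThan)

lemma finsum_mat_carrier:
  fixes f :: "'i \<Rightarrow> 'a :: comm_ring_1 mat"
  assumes "\<And>i. i \<in> I \<Longrightarrow> f i \<in> carrier_mat n n"
  shows "finsum_mat n f I \<in> carrier_mat n n"
proof -
  interpret abelian_group "module_mat TYPE('a) n n" by (rule abelian_group_mat)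
  have "finsum_mat n f I \<in> carrier (module_mat TYPE('a) n n)"
    using assms by (intro finsum_closed) (auto simp: module_mat_def)
  then show ?thesis by (simp add: module_mat_def)
qed

lemma finsum_mat_mult_vec_index:
  fixes f :: "'i \<Rightarrow> 'a :: comm_ring_1 mat"
  assumes "finite I" "\<And>i. i \<in> I \<Longrightarrow> f i \<in> carrier_mat n n" "v \<in> carrier_vec n" "r < n"
  shows "(finsum_mat n f I *\<^sub>v v) $ r = (\<Sum>i\<in>I. (f i *\<^sub>v v) $ r)"
proof -
  have carr: "finsum_mat n f I \<in> carrier_mat n n"
    using assms(2) by (rule finsum_mat_carrier)
  have "(finsum_mat n f I *\<^sub>v v) $ r = (\<Sum>c<n. \<Sum>i\<in>I. f i $$ (r, c) * v $ c)"
    using index_finsum_mat[of I f n r] assms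
    by (simp add: index_mult_mat_vec_sum[OF carr assms(3,4)] sum_distrib_right)
  also have "\<dots> = (\<Sum>i\<in>I. \<Sum>c<n. f i $$ (r, c) * v $ c)" by (rule sum.swap)
  also have "\<dots> = (\<Sum>i\<in>I. (f i *\<^sub>v v) $ r)"
    using assms by (intro sum.cong refl index_mult_mat_vec_sum[symmetric]) auto
  finally show ?thesis .
qed

text \<open>
  The vectors \<open>v j\<close> may differ, which is why the hypothesis is on the sum of the absolute values of
  the matrices and not on the absolute value of their sum.
\<close>

lemma weighted_contraction:
  fixes N :: "'i \<Rightarrow> 'a :: real_normed_field mat"
  assumes fin: "finite I" and N: "\<And>j. j \<in> I \<Longrightarrow> N j \<in> carrier_mat n n"
    and v: "\<And>j. j \<in> I \<Longrightarrow> v j \<in> carrier_vec n"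
    and bound: "\<And>j c. j \<in> I \<Longrightarrow> c < n \<Longrightarrow> norm (v j $ c) \<le> C * w c"
    and weight: "(\<Sum>c<n. (\<Sum>j\<in>I. norm (N j $$ (r, c))) * w c) \<le> \<alpha> * w r"
    and C: "0 \<le> C" and r: "r < n"
  shows "norm (\<Sum>j\<in>I. (N j *\<^sub>v v j) $ r) \<le> C * (\<alpha> * w r)"
proof -
  have "norm (\<Sum>j\<in>I. (N j *\<^sub>v v j) $ r) \<le> (\<Sum>j\<in>I. \<Sum>c<n. norm (N j $$ (r, c)) * (C * w c))"
  proof (rule sum_norm_le)
    fix j assume j: "j \<in> I"
    show "norm ((N j *\<^sub>v v j) $ r) \<le> (\<Sum>c<n. norm (N j $$ (r, c)) * (C * w c))"
      unfolding index_mult_mat_vec_sum[OF N[OF j] v[OF j] r]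
      using bound[OF j] by (intro sum_norm_le) (auto simp: norm_mult intro!: mult_left_mono)
  qed
  also have "\<dots> = (\<Sum>c<n. \<Sum>j\<in>I. norm (N j $$ (r, c)) * (C * w c))" by (rule sum.swap)
  also have "\<dots> = C * (\<Sum>c<n. (\<Sum>j\<in>I. norm (N j $$ (r, c))) * w c)"
    by (simp add: sum_distrib_left sum_distrib_right mult_ac)
  also have "\<dots> \<le> C * (\<alpha> * w r)" using weight C by (rule mult_left_mono)
  finally show ?thesis .
qed

section \<open>The asynchronous primal Schur method\<close>

lemma local_update_affine:
  assumes "J \<in> carrier_mat n n" "minv M \<in> carrier_mat n n" "S \<in> carrier_mat n n"
    and "d \<in> carrier_vec n" "x \<in> carrier_vec n"
  shows "local_update J M S d x = (J - minv M * S) *\<^sub>v x + minv M *\<^sub>v d"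
proof -
  have "local_update J M S d x = J *\<^sub>v x + (minv M *\<^sub>v d - minv M *\<^sub>v (S *\<^sub>v x))"
    using assms unfolding local_update_def by (simp add: mult_minus_distrib_mat_vec[of _ n n])
  also have "\<dots> = (J *\<^sub>v x - (minv M * S) *\<^sub>v x) + minv M *\<^sub>v d"
    using assms by (intro eq_vecI) (auto simp: assoc_mult_mat_vec[of _ n n _ n])
  also have "J *\<^sub>v x - (minv M * S) *\<^sub>v x = (J - minv M * S) *\<^sub>v x"
    using assms by (simp add: minus_mult_distrib_mat_vec[of _ n n])
  finally show ?thesis .
qed

lemma local_update_diff_index:
  assumes J: "J \<in> carrier_mat n n" and M: "minv M \<in> carrier_mat n n"
    and S: "S \<in> carrier_mat n n" and d: "d \<in> carrier_vec n"
    and x: "x \<in> carrier_vec n" and y: "y \<in> carrier_vec n" and r: "r < n"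
  shows "local_update J M S d x $ r - local_update J M S d y $ r
    = ((J - minv M * S) *\<^sub>v (x - y)) $ r"
proof -
  let ?N = "J - minv M * S"
  have N: "?N \<in> carrier_mat n n"
    using J M S by (intro minus_carrier_mat mult_carrier_mat) auto
  have index_add: "(u + v) $ r = u $ r + v $ r" if "v \<in> carrier_vec n" for u v :: "'a vec"
    using that r by auto
  have "(?N *\<^sub>v (x - y)) $ r = (?N *\<^sub>v x) $ r - (?N *\<^sub>v y) $ r"
    unfolding mult_minus_distrib_mat_vec[OF N x y]
    using mult_mat_vec_carrier[OF N y] r by (intro index_minus_vec) (simp only: carrier_vecD)
  then show ?thesis
    unfolding local_update_affine[OF J M S d x] local_update_affine[OF J M S d y]
      index_add[OF mult_mat_vec_carrier[OF M d]] by simp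
qed

lemma schur_complement_carrier:
  assumes "A_II \<in> carrier_mat m m" "invertible_mat A_II" "A_IG \<in> carrier_mat m n"
    and "A_GI \<in> carrier_mat n m" "A_GG \<in> carrier_mat n n"
  shows "schur_complement A_II A_IG A_GI A_GG \<in> carrier_mat n n"
  using assms minv_inverse(1)[OF assms(1,2)] unfolding schur_complement_def
  by (intro minus_carrier_mat mult_carrier_mat) auto

lemma condensed_rhs_carrier:
  assumes "A_II \<in> carrier_mat m m" "invertible_mat A_II" "A_GI \<in> carrier_mat n m"
    and "b_I \<in> carrier_vec m" "b_G \<in> carrier_vec n"
  shows "condensed_rhs A_II A_GI b_I b_G \<in> carrier_vec n"
  using assms minv_inverse(1)[OF assms(1,2)] unfolding condensed_rhs_def
  by (intro minus_carrier_vec mult_mat_vec_carrier mult_carrier_mat) auto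

text \<open>
  The right-hand sides are not part of the setting, because the existence of solutions is derived
  from convergence for the zero right-hand side.
\<close>

locale primal_schur =
  fixes n p :: nat and J S :: "nat \<Rightarrow> 'a :: real_normed_field mat" and M :: "'a mat"
  assumes M: "M \<in> carrier_mat n n" "invertible_mat M"
    and J: "\<And>i. i \<in> {1..p} \<Longrightarrow> J i \<in> carrier_mat n n"
    and S: "\<And>i. i \<in> {1..p} \<Longrightarrow> S i \<in> carrier_mat n n"
    and partition_of_unity: "finsum_mat n J {1..p} = 1\<^sub>m n"
    and spectral_radius_less_1:
      "real_spectral_radius (finsum_mat n (\<lambda>i. abs_mat (J i - minv M * S i)) {1..p}) < 1"
begin

text \<open>The linear part of the contribution of subdomain \<open>i\<close> to an update.\<close>

abbreviation N :: "nat \<Rightarrow> 'a mat" where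
  "N i \<equiv> J i - minv M * S i"

lemma N_carrier: "i \<in> {1..p} \<Longrightarrow> N i \<in> carrier_mat n n"
  using J S minv_inverse(1)[OF M] by (intro minus_carrier_mat mult_carrier_mat) auto

lemma S_sum_carrier: "finsum_mat n S {1..p} \<in> carrier_mat n n"
  using S by (rule finsum_mat_carrier)

lemma update_carrier:
  assumes "j \<in> {1..p}" "d \<in> carrier_vec n" "x \<in> carrier_vec n"
  shows "local_update (J j) M (S j) d x \<in> carrier_vec n"
  using assms J[OF assms(1)] S[OF assms(1)] minv_inverse(1)[OF M] unfolding local_update_def
  by (intro add_carrier_vec mult_mat_vec_carrier[of _ n n] minus_carrier_vec) auto

text \<open>
  Multiplying by \<open>M\<^sup>-\<^sup>1\<close> commutes with the sum over the subdomains, and the total residual of a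
  solution vanishes; what is left is the sum of the \<open>J\<^sub>j y\<close>.
\<close>

lemma solution_fixed_point:
  assumes d: "\<And>i. i \<in> {1..p} \<Longrightarrow> d i \<in> carrier_vec n"
    and sol: "interface_solution n p S d y"
  shows "finsum_vec TYPE('a) n (\<lambda>j. local_update (J j) M (S j) (d j) y) {1..p} = y"
proof (rule eq_vecI)
  let ?F = "finsum_vec TYPE('a) n (\<lambda>j. local_update (J j) M (S j) (d j) y) {1..p}"
  have y: "y \<in> carrier_vec n"
    and eq: "finsum_mat n S {1..p} *\<^sub>v y = finsum_vec TYPE('a) n d {1..p}"
    using sol by (auto simp: interface_solution_def)
  note minv = minv_inverse(1)[OF M]
  have F: "?F \<in> carrier_vec n"
    using update_carrier d y by (intro finsum_vec_closed) auto
  show "dim_vec ?F = dim_vec y" using F y by simp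
  fix r assume "r < dim_vec y"
  then have r: "r < n" using y by simp
  have residual: "(\<Sum>j\<in>{1..p}. (d j - S j *\<^sub>v y) $ c) = 0" if c: "c < n" for c
  proof -
    have "(\<Sum>j\<in>{1..p}. (d j - S j *\<^sub>v y) $ c) = (\<Sum>j\<in>{1..p}. d j $ c - (S j *\<^sub>v y) $ c)"
      using c S by (intro sum.cong refl index_minus_vec) auto
    also have "\<dots> = finsum_vec TYPE('a) n d {1..p} $ c - (finsum_mat n S {1..p} *\<^sub>v y) $ c"
    proof -
      have "(finsum_mat n S {1..p} *\<^sub>v y) $ c = (\<Sum>j\<in>{1..p}. (S j *\<^sub>v y) $ c)"
        using S y c by (intro finsum_mat_mult_vec_index) auto
      moreover have "finsum_vec TYPE('a) n d {1..p} $ c = (\<Sum>j\<in>{1..p}. d j $ c)"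
        using d c by (intro index_finsum_vec) auto
      ultimately show ?thesis by (simp only: sum_subtractf)
    qed
    finally show ?thesis unfolding eq by simp
  qed
  have res: "d j - S j *\<^sub>v y \<in> carrier_vec n" if "j \<in> {1..p}" for j
    using that d S[OF that] y by (intro minus_carrier_vec mult_mat_vec_carrier) auto
  have "?F $ r = (\<Sum>j\<in>{1..p}. (J j *\<^sub>v y) $ r + (minv M *\<^sub>v (d j - S j *\<^sub>v y)) $ r)"
  proof -
    have "?F $ r = (\<Sum>j\<in>{1..p}. local_update (J j) M (S j) (d j) y $ r)"
      using r update_carrier d y by (intro index_finsum_vec) auto
    also have "\<dots> = (\<Sum>j\<in>{1..p}. (J j *\<^sub>v y) $ r + (minv M *\<^sub>v (d j - S j *\<^sub>v y)) $ r)"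
      unfolding local_update_def using r minv by (intro sum.cong refl index_add_vec) auto
    finally show ?thesis .
  qed
  also have "(\<Sum>j\<in>{1..p}. (J j *\<^sub>v y) $ r + (minv M *\<^sub>v (d j - S j *\<^sub>v y)) $ r) =
      (finsum_mat n J {1..p} *\<^sub>v y) $ r
      + (\<Sum>j\<in>{1..p}. \<Sum>c<n. minv M $$ (r, c) * (d j - S j *\<^sub>v y) $ c)"
  proof -
    have "(finsum_mat n J {1..p} *\<^sub>v y) $ r = (\<Sum>j\<in>{1..p}. (J j *\<^sub>v y) $ r)"
      using J y r by (intro finsum_mat_mult_vec_index) auto
    then show ?thesis using index_mult_mat_vec_sum[OF minv res r] by (simp add: sum.distrib)
  qed
  also have "(\<Sum>j\<in>{1..p}. \<Sum>c<n. minv M $$ (r, c) * (d j - S j *\<^sub>v y) $ c) = 0"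
  proof (subst sum.swap, rule sum.neutral, rule ballI)
    fix c assume "c \<in> {..<n}"
    then show "(\<Sum>j\<in>{1..p}. minv M $$ (r, c) * (d j - S j *\<^sub>v y) $ c) = 0"
      unfolding sum_distrib_left[symmetric] using residual[of c] by simp
  qed
  finally show "?F $ r = y $ r" unfolding partition_of_unity using y by simp
qed

lemma contraction_weight:
  "\<exists>\<alpha> w. 0 < \<alpha> \<and> \<alpha> < 1 \<and> (\<forall>r<n. 0 < w r) \<and>
    (\<forall>r<n. (\<Sum>c<n. (\<Sum>j\<in>{1..p}. norm (N j $$ (r, c))) * w c) \<le> \<alpha> * w r)"
proof -
  let ?B = "finsum_mat n (\<lambda>i. abs_mat (N i)) {1..p}"
  have entry: "?B $$ (r, c) = (\<Sum>j\<in>{1..p}. norm (N j $$ (r, c)))" if "r < n" "c < n" for r c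
  proof -
    have "?B $$ (r, c) = (\<Sum>j\<in>{1..p}. abs_mat (N j) $$ (r, c))"
      using index_finsum_mat[of "{1..p}" "\<lambda>i. abs_mat (N i)" n r c] that N_carrier by auto
    also have "\<dots> = (\<Sum>j\<in>{1..p}. norm (N j $$ (r, c)))"
      using that N_carrier by (intro sum.cong refl index_map_mat) (metis carrier_matD(1), metis carrier_matD(2))
    finally show ?thesis .
  qed
  have B: "?B \<in> carrier_mat n n"
    using N_carrier by (intro finsum_mat_carrier) simp
  have "0 \<le> ?B $$ (r, c)" if "r < n" "c < n" for r c
    unfolding entry[OF that] by (intro sum_nonneg norm_ge_zero)
  from nonneg_mat_positive_weight[OF B this spectral_radius_less_1]
  obtain \<alpha> w where w: "0 < \<alpha>" "\<alpha> < 1" "\<forall>r<n. 0 < w r"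
    "\<forall>r<n. (\<Sum>c<n. ?B $$ (r, c) * w c) \<le> \<alpha> * w r" by blast
  have "(\<Sum>c<n. (\<Sum>j\<in>{1..p}. norm (N j $$ (r, c))) * w c) \<le> \<alpha> * w r" if "r < n" for r
  proof -
    have "(\<Sum>c<n. (\<Sum>j\<in>{1..p}. norm (N j $$ (r, c))) * w c) = (\<Sum>c<n. ?B $$ (r, c) * w c)"
      using that by (intro sum.cong refl) (simp only: entry lessThan_iff)
    then show ?thesis using w(4) that by simp
  qed
  then show ?thesis using w(1-3) by (intro exI[of _ \<alpha>] exI[of _ w]) blast
qed

text \<open>
  \<open>X t\<close> is the box around \<open>y\<close> with half-widths \<open>C \<alpha>\<^sup>t w\<close>; the weight makes each update map data
  in \<open>X t\<close> to \<open>X (Suc t)\<close>.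
\<close>

lemma iterates_tendsto_solution:
  assumes d: "\<And>i. i \<in> {1..p} \<Longrightarrow> d i \<in> carrier_vec n"
    and sol: "interface_solution n p S d y"
    and sched: "async_schedule p P \<tau>"
    and iter: "async_primal_schur_iterates n p J M S d P \<tau> x"
    and i: "i \<in> {1..p}"
  shows "vec_tendsto n (x i) y"
proof -
  from contraction_weight obtain \<alpha> w where \<alpha>: "0 < \<alpha>" "\<alpha> < 1"
    and w_all: "\<forall>r<n. 0 < w r"
    and weight_all: "\<forall>r<n. (\<Sum>c<n. (\<Sum>j\<in>{1..p}. norm (N j $$ (r, c))) * w c) \<le> \<alpha> * w r"
    by blast
  note w = w_all[rule_format] and weight = weight_all[rule_format]
  have y: "y \<in> carrier_vec n" using sol by (simp add: interface_solution_def)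
  \<comment> \<open>Any bound of the initial errors in the weighted maximum norms serves; a sum avoids maxima over
     index sets that may be empty.\<close>
  define C where "C = (\<Sum>j\<in>{1..p}. \<Sum>r<n. norm (x j 0 $ r - y $ r) / w r)"
  have C: "0 \<le> C" unfolding C_def using w by (intro sum_nonneg divide_nonneg_pos) auto
  define X where
    "X t = {v \<in> carrier_vec n. \<forall>r<n. norm (v $ r - y $ r) \<le> (C * \<alpha> ^ t) * w r}" for t
  have eventually_X: "\<exists>K. \<forall>k\<ge>K. \<forall>i\<in>{1..p}. x i k \<in> X t" for t
  proof (rule async_nested_sets[OF sched])
    show "X (Suc t) \<subseteq> X t" for t
    proof -
      have "(C * \<alpha> ^ Suc t) * w r \<le> (C * \<alpha> ^ t) * w r" if "r < n" for r
        using \<alpha> C w[OF that]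
        by (intro mult_right_mono mult_left_mono power_decreasing) auto
      then show ?thesis unfolding X_def by (force intro: order_trans)
    qed
  next
    fix j assume j: "j \<in> {1..p}"
    have "norm (x j 0 $ r - y $ r) \<le> (C * \<alpha> ^ 0) * w r" if r: "r < n" for r
    proof -
      have "norm (x j 0 $ r - y $ r) / w r \<le> (\<Sum>r<n. norm (x j 0 $ r - y $ r) / w r)"
        using r w by (intro member_le_sum) (auto intro: divide_nonneg_pos)
      also have "\<dots> \<le> C"
        unfolding C_def using j w
        by (intro member_le_sum sum_nonneg) (auto intro!: sum_nonneg divide_nonneg_pos)
      finally show ?thesis using w[OF r] by (simp add: field_simps)
    qed
    then show "x j 0 \<in> X 0"
      using iter j by (auto simp: X_def async_primal_schur_iterates_def)
  next
    show "x i (Suc k) = x i k" if "i \<in> {1..p}" "i \<notin> P k" for i k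
      using iter that by (auto simp: async_primal_schur_iterates_def)
  next
    fix i k t
    assume i: "i \<in> {1..p}" "i \<in> P k"
      and in_X: "\<And>j. j \<in> {1..p} \<Longrightarrow> x j (\<tau> i j k) \<in> X t"
    let ?z = "\<lambda>j. x j (\<tau> i j k)"
    let ?F = "\<lambda>v. finsum_vec TYPE('a) n (\<lambda>j. local_update (J j) M (S j) (d j) (v j)) {1..p}"
    have z: "?z j \<in> carrier_vec n" if "j \<in> {1..p}" for j using in_X[OF that] by (simp add: X_def)
    have x_Suc: "x i (Suc k) = ?F ?z"
      using iter i by (auto simp: async_primal_schur_iterates_def)
    have "?F ?z \<in> carrier_vec n"
      using update_carrier d z by (intro finsum_vec_closed) auto
    moreover have "norm (?F ?z $ r - y $ r) \<le> (C * \<alpha> ^ Suc t) * w r" if r: "r < n" for r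
    proof -
      have "?F ?z $ r - y $ r = ?F ?z $ r - ?F (\<lambda>_. y) $ r"
        using solution_fixed_point[OF d sol] by simp
      also have "\<dots> = (\<Sum>j\<in>{1..p}. local_update (J j) M (S j) (d j) (?z j) $ r
          - local_update (J j) M (S j) (d j) y $ r)"
        using r update_carrier d y z by (simp add: index_finsum_vec sum_subtractf Pi_def)
      also have "\<dots> = (\<Sum>j\<in>{1..p}. (N j *\<^sub>v (?z j - y)) $ r)"
      proof (rule sum.cong[OF refl])
        fix j assume j: "j \<in> {1..p}"
        show "local_update (J j) M (S j) (d j) (?z j) $ r - local_update (J j) M (S j) (d j) y $ r
            = (N j *\<^sub>v (?z j - y)) $ r"
          by (rule local_update_diff_index[OF J[OF j] minv_inverse(1)[OF M] S[OF j] d[OF j] z[OF j] y r])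
      qed
      finally have "?F ?z $ r - y $ r = (\<Sum>j\<in>{1..p}. (N j *\<^sub>v (?z j - y)) $ r)" .
      moreover have "norm (\<Sum>j\<in>{1..p}. (N j *\<^sub>v (?z j - y)) $ r) \<le> (C * \<alpha> ^ t) * (\<alpha> * w r)"
      proof (rule weighted_contraction)
        show "norm ((?z j - y) $ c) \<le> (C * \<alpha> ^ t) * w c" if "j \<in> {1..p}" "c < n" for j c
          using in_X[OF that(1)] that(2) y by (simp add: X_def)
      qed (use N_carrier z y weight C \<alpha> r in auto)
      ultimately show ?thesis by (simp add: mult_ac)
    qed
    ultimately show "x i (Suc k) \<in> X (Suc t)" by (simp add: X_def x_Suc)
  qed
  show ?thesis unfolding vec_tendsto_def
  proof (intro allI impI LIMSEQ_I)
    fix r and e :: real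
    assume r: "r < n" and e: "0 < e"
    have "(\<lambda>t. (C * \<alpha> ^ t) * w r) \<longlonglongrightarrow> (C * 0) * w r"
      using \<alpha> by (intro tendsto_intros LIMSEQ_power_zero) simp
    then have "eventually (\<lambda>t. (C * \<alpha> ^ t) * w r < e) sequentially"
      using e by (intro order_tendstoD(2)) auto
    then obtain t where t: "(C * \<alpha> ^ t) * w r < e"
      by (auto simp: eventually_sequentially)
    from eventually_X[of t] obtain K where "\<forall>k\<ge>K. x i k \<in> X t" using i by blast
    then have "\<forall>k\<ge>K. norm (x i k $ r - y $ r) < e"
      using t r unfolding X_def by (force intro: le_less_trans)
    then show "\<exists>K. \<forall>k\<ge>K. norm (x i k $ r - y $ r) < e" by blast
  qed
qed

text \<open>
  The constant sequence \<open>y\<close> is a run of the method, with all subdomains active and no delays; it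
  converges to \<open>z\<close>.
\<close>

lemma solution_unique:
  assumes p: "1 \<le> p" and d: "\<And>i. i \<in> {1..p} \<Longrightarrow> d i \<in> carrier_vec n"
    and y: "interface_solution n p S d y" and z: "interface_solution n p S d z"
  shows "y = z"
proof (rule eq_vecI)
  have car: "y \<in> carrier_vec n" "z \<in> carrier_vec n"
    using y z by (auto simp: interface_solution_def)
  then show "dim_vec y = dim_vec z" by simp
  have "async_schedule p (\<lambda>_. {1..p}) (\<lambda>_ _ k. k)"
    by (auto simp: async_schedule_def filterlim_ident)
  moreover have "async_primal_schur_iterates n p J M S d (\<lambda>_. {1..p}) (\<lambda>_ _ k. k) (\<lambda>_ _. y)"
    using solution_fixed_point[OF d y] car by (simp add: async_primal_schur_iterates_def)
  ultimately have "vec_tendsto n (\<lambda>_. y) z"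
    using iterates_tendsto_solution[OF d z, where i = 1] p by simp
  then show "y $ r = z $ r" if "r < dim_vec z" for r
    using that car by (auto simp: vec_tendsto_def LIMSEQ_const_iff)
qed

text \<open>Uniqueness for the zero right-hand side is injectivity of the interface matrix.\<close>

lemma solution_exists:
  assumes p: "1 \<le> p" and d: "\<And>i. i \<in> {1..p} \<Longrightarrow> d i \<in> carrier_vec n"
  shows "\<exists>y. interface_solution n p S d y"
proof -
  let ?S = "finsum_mat n S {1..p}"
  have zero: "finsum_vec TYPE('a) n (\<lambda>_. 0\<^sub>v n) {1..p} = 0\<^sub>v n"
    using finsum_vec_closed[of "\<lambda>_. 0\<^sub>v n :: 'a vec" "{1..p}" n]
    by (intro eq_vecI) (auto simp: index_finsum_vec)
  have "det ?S \<noteq> 0"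
  proof
    assume "det ?S = 0"
    then obtain v where v: "v \<in> carrier_vec n" "v \<noteq> 0\<^sub>v n" "?S *\<^sub>v v = 0\<^sub>v n"
      using det_0_iff_vec_prod_zero_field[OF S_sum_carrier] by blast
    have "interface_solution n p S (\<lambda>_. 0\<^sub>v n) v" "interface_solution n p S (\<lambda>_. 0\<^sub>v n) (0\<^sub>v n)"
      unfolding interface_solution_def zero using v S_sum_carrier by auto
    then show False using solution_unique[OF p, of "\<lambda>_. 0\<^sub>v n"] v by simp
  qed
  then obtain R where R: "R \<in> carrier_mat n n" "?S * R = 1\<^sub>m n"
    using det_non_zero_imp_unit[OF S_sum_carrier, of "()"]
    unfolding Units_def ring_mat_def by auto
  have d_sum: "finsum_vec TYPE('a) n d {1..p} \<in> carrier_vec n"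
    using d by (intro finsum_vec_closed) auto
  have "interface_solution n p S d (R *\<^sub>v finsum_vec TYPE('a) n d {1..p})"
    using R d_sum S_sum_carrier unfolding interface_solution_def
    by (simp add: assoc_mult_mat_vec[symmetric, of _ n n _ n])
  then show ?thesis by blast
qed

end

theorem theorem14:
  fixes n p :: nat and m :: "nat \<Rightarrow> nat"
    and A_II A_IG A_GI A_GG S J :: "nat \<Rightarrow> 'a :: real_normed_field mat"
    and b_I b_G d :: "nat \<Rightarrow> 'a vec"
    and M :: "'a mat"
  assumes "p \<ge> 1"
    and "\<And>i. i \<in> {1..p} \<Longrightarrow> A_II i \<in> carrier_mat (m i) (m i)"
    and "\<And>i. i \<in> {1..p} \<Longrightarrow> invertible_mat (A_II i)"
    and "\<And>i. i \<in> {1..p} \<Longrightarrow> A_IG i \<in> carrier_mat (m i) n"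
    and "\<And>i. i \<in> {1..p} \<Longrightarrow> A_GI i \<in> carrier_mat n (m i)"
    and "\<And>i. i \<in> {1..p} \<Longrightarrow> A_GG i \<in> carrier_mat n n"
    and "\<And>i. i \<in> {1..p} \<Longrightarrow> b_I i \<in> carrier_vec (m i)"
    and "\<And>i. i \<in> {1..p} \<Longrightarrow> b_G i \<in> carrier_vec n"
    and "\<And>i. i \<in> {1..p} \<Longrightarrow> S i = schur_complement (A_II i) (A_IG i) (A_GI i) (A_GG i)"
    and "\<And>i. i \<in> {1..p} \<Longrightarrow> d i = condensed_rhs (A_II i) (A_GI i) (b_I i) (b_G i)"
    and "M \<in> carrier_mat n n" and "invertible_mat M"
    and "\<And>i. i \<in> {1..p} \<Longrightarrow> J i \<in> carrier_mat n n"
    and "finsum_mat n J {1..p} = 1\<^sub>m n"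
    and "real_spectral_radius (finsum_mat n (\<lambda>i. abs_mat (J i - minv M * S i)) {1..p}) < 1"
  shows "async_primal_schur_convergent n p J M S d"
proof -
  have S: "S i \<in> carrier_mat n n" if "i \<in> {1..p}" for i
    unfolding assms(9)[OF that]
    using assms(2-6)[OF that] by (intro schur_complement_carrier)
  have d: "d i \<in> carrier_vec n" if "i \<in> {1..p}" for i
    unfolding assms(10)[OF that]
    using assms(2,3,5,7,8)[OF that] by (intro condensed_rhs_carrier)
  interpret primal_schur n p J S M
    using S assms(11-15) by unfold_locales auto
  show ?thesis
    unfolding async_primal_schur_convergent_def
    using solution_exists[of d] solution_unique[of d] iterates_tendsto_solution[of d] d \<open>p \<ge> 1\<close>
    by blast
qed

end
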